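(* Let $X$ be a $Q^*$-normal topological space, let $Y$ be a topological space, and let $f:X\to Y$ be an open continuous injective function. Then the image $f(X)$ (with the subspace topology from $Y$) is $Q^*$-normal.
   Context: No separation axioms are assumed on topological spaces. A function is open if it maps open sets to open sets. A subset $A$ of a space $X$ is $Q^*$-closed if $A$ is closed and $int(A)=\emptyset$. A space $X$ is $Q^*$-normal if for every pair of disjoint $Q^*$-closed subsets $A$, $B$ of $X$ there exist disjoint open sets $U$, $V$ of $X$ such that $A\subset U$ and $B\subset V$. *)

theory Defs
  imports "HOL-Analysis.Analysis"
begin

definition qstar_closedin :: "'a topology \<Rightarrow> 'a set \<Rightarrow> bool" where
  "qstar_closedin X A \<longleftrightarrow> closedin X A \<and> X interior_of A = {}"

definition qstar_normal_space :: "'a topology \<Rightarrow> bool" where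
  "qstar_normal_space X \<longleftrightarrow>
     (\<forall>A B. qstar_closedin X A \<and> qstar_closedin X B \<and> disjnt A B \<longrightarrow>
        (\<exists>U V. openin X U \<and> openin X V \<and> A \<subseteq> U \<and> B \<subseteq> V \<and> disjnt U V))"

end

theory Submission
  imports Defs
begin

text \<open>An open continuous injection is a homeomorphism onto its image, so it is enough that
  Q*-normality is a topological invariant (\<open>qstar_normal_space_homeomorphic_map\<close>). This
  holds because homeomorphisms preserve both closedness and emptiness of the interior
  (\<open>qstar_closedin_homeomorphic_image\<close>), hence the sets to be separated, as well as the
  open sets separating them.\<close>

lemma qstar_closedin_homeomorphic_image:
  assumes "homeomorphic_map X Y f" "qstar_closedin X A"
  shows "qstar_closedin Y (f ` A)"
proof -
  have A: "closedin X A" "X interior_of A = {}"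
    using assms(2) by (auto simp: qstar_closedin_def)
  then have sub: "A \<subseteq> topspace X"
    by (simp add: closedin_subset)
  show ?thesis
    using A homeomorphic_map_closedness[OF assms(1) sub]
      homeomorphic_map_interior_of[OF assms(1) sub]
    by (simp add: qstar_closedin_def)
qed

text \<open>Pull the two sets back along the inverse \<open>g\<close>, separate them in
  \<open>X\<close>, and push the separating open sets forward along \<open>f\<close>.\<close>

lemma qstar_normal_space_homeomorphic_map:
  assumes hom: "homeomorphic_map X Y f" and X: "qstar_normal_space X"
  shows "qstar_normal_space Y"
  unfolding qstar_normal_space_def
proof (intro allI impI, elim conjE)
  fix A B
  assume A: "qstar_closedin Y A" and B: "qstar_closedin Y B" and AB: "disjnt A B"
  obtain g where fg: "homeomorphic_maps X Y f g"
    using hom homeomorphic_map_maps by blast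
  then have g: "homeomorphic_map Y X g"
    using homeomorphic_maps_map by blast
  have fg_id: "f (g y) = y" if "y \<in> topspace Y" for y
    using fg that by (simp add: homeomorphic_maps_def)
  have sub: "A \<subseteq> topspace Y" "B \<subseteq> topspace Y"
    using A B by (simp_all add: qstar_closedin_def closedin_subset)
  \<comment> \<open>Images under an injective map commute with intersections; \<open>g\<close> is
    known to be injective only on \<open>topspace Y\<close>, hence the need for
    \<open>sub\<close>.\<close>
  have "disjnt (g ` A) (g ` B)"
    using AB inj_on_image_Int[OF homeomorphic_imp_injective_map[OF g] sub]
    by (simp add: disjnt_def)
  moreover have "qstar_closedin X (g ` A)" "qstar_closedin X (g ` B)"
    using qstar_closedin_homeomorphic_image[OF g] A B by simp_all
  ultimately obtain U V
    where UV: "openin X U" "openin X V" "g ` A \<subseteq> U" "g ` B \<subseteq> V" "disjnt U V"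
    using X unfolding qstar_normal_space_def by meson
  have opens: "openin Y (f ` U)" "openin Y (f ` V)"
    using UV homeomorphic_imp_open_map[OF hom] by (simp_all add: open_map_def)
  have "disjnt (f ` U) (f ` V)"
    using UV(5) inj_on_image_Int[OF homeomorphic_imp_injective_map[OF hom]
        openin_subset[OF UV(1)] openin_subset[OF UV(2)]]
    by (simp add: disjnt_def)
  \<comment> \<open>The round trip through \<open>X\<close> returns the original sets, so applying
    \<open>f\<close> to \<open>g\<close> A \<subseteq> U\<open>and\<close>g
    \<open>B \<subseteq> V\<close> gives the required covers.\<close>
  moreover have "f ` g ` A = A" "f ` g ` B = B"
    using sub fg_id by (simp_all add: image_image subset_eq)
  then have "A \<subseteq> f ` U" "B \<subseteq> f ` V"
    using image_mono[OF UV(3), of f] image_mono[OF UV(4), of f] by simp_all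
  ultimately show "\<exists>U V. openin Y U \<and> openin Y V \<and> A \<subseteq> U \<and> B \<subseteq> V \<and> disjnt U V"
    using opens by blast
qed

theorem theorem2p11:
  fixes X :: "'a topology" and Y :: "'b topology" and f :: "'a \<Rightarrow> 'b"
  assumes "qstar_normal_space X"
    and "open_map X Y f"
    and "continuous_map X Y f"
    and "inj_on f (topspace X)"
  shows "qstar_normal_space (subtopology Y (f ` topspace X))"
proof -
  have "embedding_map X Y f"
    using assms injective_open_imp_embedding_map by blast
  then show ?thesis
    using assms(1) qstar_normal_space_homeomorphic_map
    unfolding embedding_map_def by blast
qed

end
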